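(* A finite left nilpotent algebra has a Maltsev polynomial if and only if it has a pointed cube polynomial.
   Context: An algebra $\mathbf{A}$ is left nilpotent if $[1_{\mathbf A},\dots,[1_{\mathbf A},[1_{\mathbf A},1_{\mathbf A}]]\dots]=0_{\mathbf A}$ for a sufficiently long expression, using the term condition commutator. A Maltsev polynomial is a polynomial $m$ with $m(x,y,y)=x=m(y,y,x)$. A term $F(x_1,\dots,x_m)$ is a $p$-pointed $k$-cube term if there is a $k\times m$ matrix $M$ of variables and $p$ distinct constant symbols, every column containing a symbol different from the variable $x$, with $F(M)\approx(x,\dots,x)^T$ (row-wise); a pointed cube polynomial of $\mathbf{A}$ is a pointed cube term of the expansion of $\mathbf{A}$ by all constants. *)

theory Defs
  imports Main
begin

definition is_algebra :: "'a set \<Rightarrow> ('f \<Rightarrow> nat) \<Rightarrow> ('f \<Rightarrow> 'a list \<Rightarrow> 'a) \<Rightarrow> bool" where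
  "is_algebra A ar ops \<longleftrightarrow> A \<noteq> {} \<and>
     (\<forall>f xs. length xs = ar f \<and> set xs \<subseteq> A \<longrightarrow> ops f xs \<in> A)"

inductive_set term_ops :: "('f \<Rightarrow> nat) \<Rightarrow> ('f \<Rightarrow> 'a list \<Rightarrow> 'a) \<Rightarrow> nat \<Rightarrow> ('a list \<Rightarrow> 'a) set"
  for ar ops n where
  proj: "i < n \<Longrightarrow> (\<lambda>xs. xs ! i) \<in> term_ops ar ops n"
| app: "length gs = ar f \<Longrightarrow> (\<forall>g\<in>set gs. g \<in> term_ops ar ops n) \<Longrightarrow>
        (\<lambda>xs. ops f (map (\<lambda>g. g xs) gs)) \<in> term_ops ar ops n"

inductive_set pol_ops :: "'a set \<Rightarrow> ('f \<Rightarrow> nat) \<Rightarrow> ('f \<Rightarrow> 'a list \<Rightarrow> 'a) \<Rightarrow> nat \<Rightarrow> ('a list \<Rightarrow> 'a) set"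
  for A ar ops n where
  proj: "i < n \<Longrightarrow> (\<lambda>xs. xs ! i) \<in> pol_ops A ar ops n"
| const: "c \<in> A \<Longrightarrow> (\<lambda>xs. c) \<in> pol_ops A ar ops n"
| app: "length gs = ar f \<Longrightarrow> (\<forall>g\<in>set gs. g \<in> pol_ops A ar ops n) \<Longrightarrow>
        (\<lambda>xs. ops f (map (\<lambda>g. g xs) gs)) \<in> pol_ops A ar ops n"

definition is_congruence :: "'a set \<Rightarrow> ('f \<Rightarrow> nat) \<Rightarrow> ('f \<Rightarrow> 'a list \<Rightarrow> 'a) \<Rightarrow> 'a rel \<Rightarrow> bool" where
  "is_congruence A ar ops \<theta> \<longleftrightarrow> equiv A \<theta> \<and>
     (\<forall>f xs ys. length xs = ar f \<and> list_all2 (\<lambda>a b. (a, b) \<in> \<theta>) xs ys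
         \<longrightarrow> (ops f xs, ops f ys) \<in> \<theta>)"

definition centralizes :: "'a set \<Rightarrow> ('f \<Rightarrow> nat) \<Rightarrow> ('f \<Rightarrow> 'a list \<Rightarrow> 'a) \<Rightarrow> 'a rel \<Rightarrow> 'a rel \<Rightarrow> 'a rel \<Rightarrow> bool" where
  "centralizes A ar ops \<alpha> \<beta> \<delta> \<longleftrightarrow>
     (\<forall>n m t as bs cs ds. t \<in> term_ops ar ops (n + m) \<and>
        length as = n \<and> list_all2 (\<lambda>a b. (a, b) \<in> \<alpha>) as bs \<and>
        length cs = m \<and> list_all2 (\<lambda>c d. (c, d) \<in> \<beta>) cs ds \<and>
        (t (as @ cs), t (as @ ds)) \<in> \<delta>
        \<longrightarrow> (t (bs @ cs), t (bs @ ds)) \<in> \<delta>)"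

definition tc_commutator :: "'a set \<Rightarrow> ('f \<Rightarrow> nat) \<Rightarrow> ('f \<Rightarrow> 'a list \<Rightarrow> 'a) \<Rightarrow> 'a rel \<Rightarrow> 'a rel \<Rightarrow> 'a rel" where
  "tc_commutator A ar ops \<alpha> \<beta> =
     \<Inter>{\<delta>. is_congruence A ar ops \<delta> \<and> centralizes A ar ops \<alpha> \<beta> \<delta>}"

fun left_comm_iter :: "'a set \<Rightarrow> ('f \<Rightarrow> nat) \<Rightarrow> ('f \<Rightarrow> 'a list \<Rightarrow> 'a) \<Rightarrow> nat \<Rightarrow> 'a rel" where
  "left_comm_iter A ar ops 0 = A \<times> A"
| "left_comm_iter A ar ops (Suc k) = tc_commutator A ar ops (A \<times> A) (left_comm_iter A ar ops k)"

definition left_nilpotent :: "'a set \<Rightarrow> ('f \<Rightarrow> nat) \<Rightarrow> ('f \<Rightarrow> 'a list \<Rightarrow> 'a) \<Rightarrow> bool" where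
  "left_nilpotent A ar ops \<longleftrightarrow> (\<exists>k. left_comm_iter A ar ops k = Id_on A)"

definition has_maltsev_polynomial :: "'a set \<Rightarrow> ('f \<Rightarrow> nat) \<Rightarrow> ('f \<Rightarrow> 'a list \<Rightarrow> 'a) \<Rightarrow> bool" where
  "has_maltsev_polynomial A ar ops \<longleftrightarrow>
     (\<exists>m \<in> pol_ops A ar ops 3. \<forall>x\<in>A. \<forall>y\<in>A. m [x, y, y] = x \<and> m [y, y, x] = x)"

text \<open>Matrix entries: Inl i is the variable x_i (x_0 is the distinguished
variable x), Inr c is the constant symbol c (an element of A).\<close>
fun eval_entry :: "(nat \<Rightarrow> 'a) \<Rightarrow> nat + 'a \<Rightarrow> 'a" where
  "eval_entry v (Inl i) = v i"
| "eval_entry v (Inr c) = c"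

definition has_pointed_cube_polynomial :: "'a set \<Rightarrow> ('f \<Rightarrow> nat) \<Rightarrow> ('f \<Rightarrow> 'a list \<Rightarrow> 'a) \<Rightarrow> bool" where
  "has_pointed_cube_polynomial A ar ops \<longleftrightarrow>
     (\<exists>(k::nat) (m::nat) F (M :: nat \<Rightarrow> nat \<Rightarrow> nat + 'a). k \<ge> 1 \<and> F \<in> pol_ops A ar ops m \<and>
        (\<forall>r<k. \<forall>j<m. \<forall>c. M r j = Inr c \<longrightarrow> c \<in> A) \<and>
        (\<forall>j<m. \<exists>r<k. M r j \<noteq> Inl 0) \<and>
        (\<forall>v :: nat \<Rightarrow> 'a. (\<forall>i. v i \<in> A) \<longrightarrow>
           (\<forall>r<k. F (map (\<lambda>j. eval_entry v (M r j)) [0..<m]) = v 0)))"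

end

(* By centrality, two unary polynomials that differ only in their parameters ("twins") have the
   same kernel modulo each factor of the lower central series; hence a twin of a permutation of a
   finite subset V that maps V to itself is again a permutation of V. In particular, a binary
   polynomial p on V with p(-, o) and p(o, -) injective is a quasigroup operation, whose divisions
   are polynomial by finiteness, so V has a Maltsev polynomial.

   Given a cube polynomial, replace one row by an idempotent polynomial e and induct on the number
   of the other rows. Rows a and b are merged by keeping the variable only where both have it; with
   g the resulting function (followed by e) and E a large power of g, induction gives a Maltsev
   polynomial m on E(A). Let q(w, x, y) be e applied to the cube polynomial with w in the columns
   common to a and b, x in those of a only and y in those of b only. Solving inside E(A) for the
   w-argument yields polynomials s, t with s(o) = t(o) such that x -> q(s(x), x, o) and
   y -> q(t(y), o, y) are injective on e(A), and p(x, y) = q(m(s(x), s(o), t(y)), x, y) is as above. *)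

theory Submission
  imports Defs
begin

section \<open>Iterates of self-maps of finite sets\<close>

text \<open>Two of the first \<open>n + 1\<close> iterates of \<open>x\<close> coincide, so the
  orbit is periodic from an index \<open>i < n\<close> on, with a period \<open>d \<le> n\<close>;
  and \<open>fact n\<close> is a multiple of \<open>d\<close> and at least \<open>i\<close>.\<close>

lemma funpow_fact_idem:
  fixes f :: "'a \<Rightarrow> 'a"
  assumes "finite V" "card V \<le> n" "f ` V \<subseteq> V" "x \<in> V"
  shows "(f ^^ fact n) ((f ^^ fact n) x) = (f ^^ fact n) x"
proof -
  have mem: "(f ^^ i) x \<in> V" for i
    using assms by (induction i) auto
  have "\<not> inj_on (\<lambda>i. (f ^^ i) x) {..n}"
  proof
    assume "inj_on (\<lambda>i. (f ^^ i) x) {..n}"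
    then have "card {..n} \<le> card V"
      using mem assms(1) by (intro card_inj_on_le) auto
    then show False using assms(2) by simp
  qed
  then obtain i j where ij: "i < j" "j \<le> n" "(f ^^ i) x = (f ^^ j) x"
    unfolding inj_on_def by (metis atMost_iff linorder_neqE_nat)
  define d where "d = j - i"
  have d: "d > 0" "d \<le> n" "j = d + i" using ij by (auto simp: d_def)
  have per: "(f ^^ (d + l)) x = (f ^^ l) x" if "i \<le> l" for l
  proof -
    have "(f ^^ (d + l)) x = (f ^^ ((l - i) + (d + i))) x" using that by (simp add: algebra_simps)
    also have "\<dots> = (f ^^ (l - i)) ((f ^^ j) x)" by (simp only: funpow_add d(3) o_apply)
    also have "\<dots> = (f ^^ ((l - i) + i)) x" by (simp only: ij(3)[symmetric] funpow_add o_apply)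
    finally show ?thesis using that by simp
  qed
  have per': "(f ^^ (q * d + l)) x = (f ^^ l) x" if "i \<le> l" for q l
  proof (induction q)
    case (Suc q)
    have "(f ^^ (Suc q * d + l)) x = (f ^^ (d + (q * d + l))) x" by (simp add: algebra_simps)
    also have "\<dots> = (f ^^ (q * d + l)) x" using that by (intro per) simp
    finally show ?case using Suc by simp
  qed simp
  have "d dvd fact n" using d by (simp add: dvd_fact)
  then obtain q where q: "fact n = q * d" by (metis dvd_def mult.commute)
  have "i \<le> fact n" using ij fact_ge_self[of n] by linarith
  have "(f ^^ fact n) ((f ^^ fact n) x) = (f ^^ (q * d + fact n)) x"
    by (simp only: funpow_add o_apply q[symmetric])
  also have "\<dots> = (f ^^ fact n) x" by (rule per') fact
  finally show ?thesis .
qed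

lemma funpow_image_subset: "f ` V \<subseteq> V \<Longrightarrow> x \<in> V \<Longrightarrow> (f ^^ n) x \<in> V"
  by (induction n) auto

lemma funpow_fact_perm:
  fixes f :: "'a \<Rightarrow> 'a"
  assumes "finite V" "card V \<le> n" "f ` V \<subseteq> V" "inj_on f V" "x \<in> V"
  shows "(f ^^ fact n) x = x"
proof -
  have inj: "inj_on (f ^^ l) V" for l
  proof (induction l)
    case (Suc l)
    show ?case
    proof (rule inj_onI)
      fix u v assume uv: "u \<in> V" "v \<in> V" "(f ^^ Suc l) u = (f ^^ Suc l) v"
      then have "(f ^^ l) u = (f ^^ l) v"
        using assms(3,4) by (auto dest!: inj_onD intro: funpow_image_subset)
      then show "u = v" using Suc uv by (auto dest: inj_onD)
    qed
  qed simp
  show ?thesis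
    using inj_onD[OF inj funpow_fact_idem[OF assms(1,2,3,5)]]
      funpow_image_subset[OF assms(3,5)] assms(5) by simp
qed

text \<open>The power \<open>fact n - 1\<close> of a permutation is its inverse. Thus inverses are
  iterates, which keeps them polynomial.\<close>

lemma funpow_fact_solve:
  fixes f :: "'a \<Rightarrow> 'a"
  assumes "finite V" "card V \<le> n" "f ` V \<subseteq> V" "inj_on f V" "x \<in> V"
  shows "f ((f ^^ (fact n - 1)) x) = x" and "(f ^^ (fact n - 1)) (f x) = x"
proof -
  have "f ((f ^^ (fact n - 1)) x) = (f ^^ Suc (fact n - 1)) x" by (simp only: funpow.simps o_apply)
  then show "f ((f ^^ (fact n - 1)) x) = x" using funpow_fact_perm[OF assms] by simp
  have "(f ^^ (fact n - 1)) (f x) = (f ^^ Suc (fact n - 1)) x" by (simp only: funpow_Suc_right o_apply)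
  then show "(f ^^ (fact n - 1)) (f x) = x" using funpow_fact_perm[OF assms] by simp
qed

section \<open>Polynomial functions over an arbitrary index type\<close>

text \<open>The functions in \<open>G\<close> stand for the variables: coordinate functions give
  ordinary polynomials, other choices give pairs of twins or polynomials whose variables are columns
  of a matrix.\<close>

inductive_set pol :: "'a set \<Rightarrow> ('f \<Rightarrow> nat) \<Rightarrow> ('f \<Rightarrow> 'a list \<Rightarrow> 'a) \<Rightarrow> ('i \<Rightarrow> 'a) set \<Rightarrow> ('i \<Rightarrow> 'a) set"
  for A ar ops G where
  gen: "g \<in> G \<Longrightarrow> g \<in> pol A ar ops G"
| const: "c \<in> A \<Longrightarrow> (\<lambda>i. c) \<in> pol A ar ops G"
| app: "length gs = ar f \<Longrightarrow> (\<forall>g\<in>set gs. g \<in> pol A ar ops G) \<Longrightarrow>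
        (\<lambda>i. ops f (map (\<lambda>g. g i) gs)) \<in> pol A ar ops G"

lemma pol_subst:
  assumes "F \<in> pol A ar ops G" and "\<And>g. g \<in> G \<Longrightarrow> (\<lambda>j. g (\<phi> j)) \<in> pol A ar ops H"
  shows "(\<lambda>j. F (\<phi> j)) \<in> pol A ar ops H"
  using assms(1)
proof induction
  case (gen g) then show ?case by (rule assms(2))
next
  case (const c) then show ?case by (rule pol.const)
next
  case (app gs f)
  have "(\<lambda>j. ops f (map (\<lambda>h. h j) (map (\<lambda>g j. g (\<phi> j)) gs))) \<in> pol A ar ops H"
    by (rule pol.app) (use app in auto)
  then show ?case by (simp add: comp_def)
qed

lemma pol_cong:
  assumes "F \<in> pol A ar ops G" and "\<And>g. g \<in> G \<Longrightarrow> g i = g j"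
  shows "F i = F j"
  using assms(1) by induction (auto simp: assms(2) intro!: arg_cong[where f = "ops _"])

text \<open>Pairs of unary polynomials \<open>t(x, a)\<close>, \<open>t(x, b)\<close> differing only in their parameters
  are coded as a single function on \<^typ>\<open>bool \<times> 'a\<close>.\<close>

definition twin_gens :: "'a set \<Rightarrow> (bool \<times> 'a \<Rightarrow> 'a) set" where
  "twin_gens A = insert snd {\<lambda>(b, x). if b then c else c' |c c'. c \<in> A \<and> c' \<in> A}"

text \<open>The pair \<open>(T, c)\<close> stands for the column of a cube matrix that has the distinguished
  variable in the rows of \<open>T\<close> and the constant \<open>c r\<close> in any other row \<open>r\<close>;
  variables of the polynomials below are indexed by such columns.\<close>

definition cols :: "'a set \<Rightarrow> nat set \<Rightarrow> (nat set \<times> (nat \<Rightarrow> 'a)) set" where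
  "cols A J = {(T, c). T \<subset> J \<and> range c \<subseteq> A}"

definition col_gens :: "'a set \<Rightarrow> nat set \<Rightarrow> ((nat set \<times> (nat \<Rightarrow> 'a) \<Rightarrow> 'a) \<Rightarrow> 'a) set" where
  "col_gens A J = {\<lambda>\<alpha>. \<alpha> p |p. p \<in> cols A J}"

definition row :: "nat \<Rightarrow> 'a \<Rightarrow> nat set \<times> (nat \<Rightarrow> 'a) \<Rightarrow> 'a" where
  "row r x = (\<lambda>(T, c). if r \<in> T then x else c r)"

lemma pol_col_subst:
  assumes "F \<in> pol A ar ops (col_gens A J)"
    and "\<And>p. p \<in> cols A J \<Longrightarrow> (\<lambda>j. u j p) \<in> pol A ar ops H"
  shows "(\<lambda>j. F (u j)) \<in> pol A ar ops H"
  by (rule pol_subst[OF assms(1)]) (use assms(2) in \<open>auto simp: col_gens_def\<close>)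

lemma pol_col_cong:
  assumes "F \<in> pol A ar ops (col_gens A J)" and "\<And>p. p \<in> cols A J \<Longrightarrow> \<alpha> p = \<alpha>' p"
  shows "F \<alpha> = F \<alpha>'"
  by (rule pol_cong[OF assms(1)]) (use assms(2) in \<open>auto simp: col_gens_def\<close>)

abbreviation gens2 :: "('a \<times> 'a \<Rightarrow> 'a) set" where "gens2 \<equiv> {fst, snd}"

abbreviation gens3 :: "('a \<times> 'a \<times> 'a \<Rightarrow> 'a) set" where
  "gens3 \<equiv> {fst, \<lambda>x. fst (snd x), \<lambda>x. snd (snd x)}"

locale left_nilpotent_algebra =
  fixes A :: "'a set" and ar :: "'f \<Rightarrow> nat" and ops :: "'f \<Rightarrow> 'a list \<Rightarrow> 'a"
  assumes alg: "is_algebra A ar ops" and fin: "finite A" and nil: "left_nilpotent A ar ops"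
begin

abbreviation Pol :: "('i \<Rightarrow> 'a) set \<Rightarrow> ('i \<Rightarrow> 'a) set" where "Pol \<equiv> pol A ar ops"

abbreviation lcs :: "nat \<Rightarrow> 'a rel" where "lcs \<equiv> left_comm_iter A ar ops"

text \<open>One exponent for all subsets of \<open>A\<close>: the \<open>N\<close>-th power of a
  self-map is idempotent, and the power \<open>N - 1\<close> inverts a permutation.\<close>

abbreviation N :: nat where "N \<equiv> fact (card A)"

lemma Pol_closed:
  assumes "F \<in> Pol G" and "\<And>g. g \<in> G \<Longrightarrow> g i \<in> A"
  shows "F i \<in> A"
  using assms(1)
proof induction
  case (app gs f)
  then have "set (map (\<lambda>g. g i) gs) \<subseteq> A" by auto
  then show ?case using alg app(1) unfolding is_algebra_def by (metis length_map)
qed (auto simp: assms(2))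

lemma Pol_congruence:
  assumes "is_congruence A ar ops \<theta>" "F \<in> Pol G" and "\<And>g. g \<in> G \<Longrightarrow> (g i, g j) \<in> \<theta>"
  shows "(F i, F j) \<in> \<theta>"
  using assms(2)
proof induction
  case (const c)
  then show ?case using assms(1) unfolding is_congruence_def equiv_def refl_on_def by auto
next
  case (app gs f)
  have "list_all2 (\<lambda>a b. (a, b) \<in> \<theta>) (map (\<lambda>g. g i) gs) (map (\<lambda>g. g j) gs)"
    using app by (auto simp: list_all2_conv_all_nth)
  then show ?case using assms(1) app(1) unfolding is_congruence_def by simp
qed (auto simp: assms(3))

section \<open>The lower central series\<close>

lemma congruence_total: "is_congruence A ar ops (A \<times> A)"
proof -
  have "(ops f xs, ops f ys) \<in> A \<times> A"
    if "length xs = ar f" "list_all2 (\<lambda>a b. (a, b) \<in> A \<times> A) xs ys" for f xs ys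
  proof -
    have "set xs \<subseteq> A" "set ys \<subseteq> A" "length ys = ar f"
      using that by (auto simp: list_all2_conv_all_nth in_set_conv_nth)
    then show ?thesis using that alg unfolding is_algebra_def by auto
  qed
  then show ?thesis
    unfolding is_congruence_def by (auto simp: equiv_def refl_on_def sym_on_def trans_on_def)
qed

lemma term_ops_closed:
  assumes "t \<in> term_ops ar ops n" "length xs = n" "set xs \<subseteq> A"
  shows "t xs \<in> A"
  using assms(1)
proof induction
  case (proj i) then show ?case using assms by auto
next
  case (app gs f)
  then have "set (map (\<lambda>g. g xs) gs) \<subseteq> A" by auto
  then show ?case using alg app(1) unfolding is_algebra_def by (metis length_map)
qed

text \<open>Makes the family intersected in \<open>tc_commutator\<close> nonempty; an empty
  intersection would be the full relation on the type rather than on \<open>A\<close>.\<close>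

lemma centralizes_total:
  assumes "\<beta> \<subseteq> A \<times> A"
  shows "centralizes A ar ops (A \<times> A) \<beta> (A \<times> A)"
  unfolding centralizes_def
proof (intro allI impI, elim conjE)
  fix n m t as bs cs ds
  assume h: "t \<in> term_ops ar ops (n + m)" "length as = n" "list_all2 (\<lambda>a b. (a, b) \<in> A \<times> A) as bs"
    "length cs = m" "list_all2 (\<lambda>c d. (c, d) \<in> \<beta>) cs ds"
  have "set bs \<subseteq> A" "length bs = n" using h(2,3) by (auto simp: list_all2_conv_all_nth in_set_conv_nth)
  moreover have "set cs \<subseteq> A" "set ds \<subseteq> A" "length ds = m"
    using h(4,5) assms by (fastforce simp: list_all2_conv_all_nth in_set_conv_nth)+
  ultimately show "(t (bs @ cs), t (bs @ ds)) \<in> A \<times> A"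
    using h(4) term_ops_closed[OF h(1)] by simp
qed

lemma congruence_Inter:
  assumes "S \<noteq> {}" "\<And>\<theta>. \<theta> \<in> S \<Longrightarrow> is_congruence A ar ops \<theta>"
  shows "is_congruence A ar ops (\<Inter>S)"
proof -
  obtain \<theta>0 where "\<theta>0 \<in> S" using assms(1) by auto
  then have "\<theta>0 \<subseteq> A \<times> A" using assms(2) by (auto simp: is_congruence_def equiv_def refl_on_def)
  then have sub: "\<Inter>S \<subseteq> A \<times> A" using \<open>\<theta>0 \<in> S\<close> by auto
  have eq: "equiv A \<theta>" if "\<theta> \<in> S" for \<theta> using assms(2)[OF that] by (simp add: is_congruence_def)
  have "equiv A (\<Inter>S)"
  proof (rule equivI)
    show "\<Inter>S \<subseteq> A \<times> A" by (rule sub)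
    show "refl_on A (\<Inter>S)"
    proof (rule refl_onI)
      fix x assume "x \<in> A"
      then show "(x, x) \<in> \<Inter>S" using eq by (blast dest: equivE refl_onD)
    qed
    show "sym (\<Inter>S)"
    proof (rule symI, rule InterI)
      fix x y \<theta> assume "(x, y) \<in> \<Inter>S" "\<theta> \<in> S"
      then show "(y, x) \<in> \<theta>" using eq[of \<theta>] by (metis InterD equivE symD)
    qed
    show "trans (\<Inter>S)"
    proof (rule transI, rule InterI)
      fix x y z \<theta> assume "(x, y) \<in> \<Inter>S" "(y, z) \<in> \<Inter>S" "\<theta> \<in> S"
      then show "(x, z) \<in> \<theta>" using eq[of \<theta>] by (metis InterD equivE transD)
    qed
  qed
  moreover have "(ops f xs, ops f ys) \<in> \<Inter>S"
    if "length xs = ar f" "list_all2 (\<lambda>a b. (a, b) \<in> \<Inter>S) xs ys" for f xs ys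
  proof
    fix \<theta> assume "\<theta> \<in> S"
    then have "list_all2 (\<lambda>a b. (a, b) \<in> \<theta>) xs ys"
      using that(2) by (auto elim: list_all2_mono)
    then show "(ops f xs, ops f ys) \<in> \<theta>"
      using that(1) assms(2)[OF \<open>\<theta> \<in> S\<close>] unfolding is_congruence_def by blast
  qed
  ultimately show ?thesis unfolding is_congruence_def by blast
qed

lemma congruence_subset: "is_congruence A ar ops \<theta> \<Longrightarrow> \<theta> \<subseteq> A \<times> A"
  by (auto simp: is_congruence_def equiv_def)

lemma lcs_congruence: "is_congruence A ar ops (lcs k)"
proof (induction k)
  case 0 show ?case by (simp add: congruence_total)
next
  case (Suc k)
  show ?case
    unfolding left_comm_iter.simps tc_commutator_def
    using centralizes_total[OF congruence_subset[OF Suc]] congruence_total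
    by (intro congruence_Inter) auto
qed

text \<open>For fixed \<alpha> and \<beta> the term condition consists of implications between
  memberships in \<delta>, so it survives intersections of \<delta>.\<close>

lemma lcs_centralizes: "centralizes A ar ops (A \<times> A) (lcs k) (lcs (Suc k))"
  unfolding left_comm_iter.simps tc_commutator_def centralizes_def by blast

lemma lcs_refl: "x \<in> A \<Longrightarrow> (x, x) \<in> lcs k"
  using lcs_congruence[of k] by (auto simp: is_congruence_def equiv_def refl_on_def)

lemma lcs_sym: "(x, y) \<in> lcs k \<Longrightarrow> (y, x) \<in> lcs k"
  using lcs_congruence[of k] by (auto simp: is_congruence_def equiv_def sym_on_def)

lemma lcs_trans: "(x, y) \<in> lcs k \<Longrightarrow> (y, z) \<in> lcs k \<Longrightarrow> (x, z) \<in> lcs k"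
  using lcs_congruence[of k] unfolding is_congruence_def equiv_def trans_on_def by blast

text \<open>Induction down the series: \<open>lcs 0\<close> is total and some \<open>lcs k\<close>
  is equality on \<open>A\<close>. Later injectivity proofs thereby work in one factor at a
  time.\<close>

lemma eq_by_lcs:
  assumes "x \<in> A" "y \<in> A" "\<And>k. (x, y) \<in> lcs k \<Longrightarrow> (x, y) \<in> lcs (Suc k)"
  shows "x = y"
proof -
  have "(x, y) \<in> lcs k" for k using assms by (induction k) auto
  then show ?thesis using nil unfolding left_nilpotent_def by (metis IdI Id_on_iff)
qed

declare left_comm_iter.simps(2) [simp del]

section \<open>Twin polynomials\<close>

definition twin :: "('a \<Rightarrow> 'a) \<Rightarrow> ('a \<Rightarrow> 'a) \<Rightarrow> bool" where
  "twin f f' \<longleftrightarrow> (\<lambda>(b, x). if b then f x else f' x) \<in> Pol (twin_gens A)"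

lemma twinD: "twin f f' \<Longrightarrow> (\<lambda>i. if fst i then f (snd i) else f' (snd i)) \<in> Pol (twin_gens A)"
  by (simp add: twin_def case_prod_beta')

lemma twinI: "(\<lambda>i. if fst i then f (snd i) else f' (snd i)) \<in> Pol (twin_gens A) \<Longrightarrow> twin f f'"
  by (simp add: twin_def case_prod_beta')

lemma twin_id: "twin (\<lambda>x. x) (\<lambda>x. x)"
  using pol.gen[of snd "twin_gens A" A ar ops] by (intro twinI) (simp add: twin_gens_def)

lemma twin_const: "c \<in> A \<Longrightarrow> c' \<in> A \<Longrightarrow> twin (\<lambda>x. c) (\<lambda>x. c')"
  unfolding twin_def by (rule pol.gen) (auto simp: twin_gens_def)

lemma twin_comp:
  assumes "twin f f'" "twin g g'"
  shows "twin (\<lambda>x. f (g x)) (\<lambda>x. f' (g' x))"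
proof (rule twinI)
  let ?\<phi> = "\<lambda>i. (fst i, if fst i then g (snd i) else g' (snd i))"
  have "(\<lambda>i. (\<lambda>i. if fst i then f (snd i) else f' (snd i)) (?\<phi> i)) \<in> Pol (twin_gens A)"
  proof (rule pol_subst[OF twinD[OF assms(1)]])
    fix h assume h: "h \<in> twin_gens A"
    then consider "h = snd" | c c' where "c \<in> A" "c' \<in> A" "h = (\<lambda>(b, x). if b then c else c')"
      by (auto simp: twin_gens_def)
    then show "(\<lambda>j. h (?\<phi> j)) \<in> Pol (twin_gens A)"
    proof cases
      case 1 then show ?thesis using twinD[OF assms(2)] by simp
    next
      case 2 then show ?thesis using twinD[OF twin_const[OF 2(1,2)]] by simp
    qed
  qed
  then show "(\<lambda>i. if fst i then f (g (snd i)) else f' (g' (snd i))) \<in> Pol (twin_gens A)"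
    by (simp add: if_distrib cong: if_cong)
qed

lemma twin_sym: assumes "twin f f'" shows "twin f' f"
proof (rule twinI)
  have "(\<lambda>i. (\<lambda>i. if fst i then f (snd i) else f' (snd i)) (\<not> fst i, snd i)) \<in> Pol (twin_gens A)"
  proof (rule pol_subst[OF twinD[OF assms]])
    fix h assume h: "h \<in> twin_gens A"
    then consider "h = snd" | c c' where "c \<in> A" "c' \<in> A" "h = (\<lambda>(b, x). if b then c else c')"
      by (auto simp: twin_gens_def)
    then show "(\<lambda>j. h (\<not> fst j, snd j)) \<in> Pol (twin_gens A)"
    proof cases
      case 1 then show ?thesis using twinD[OF twin_id] by simp
    next
      case 2
      then have "(\<lambda>j. h (\<not> fst j, snd j)) = (\<lambda>i. if fst i then c' else c)" by auto
      then show ?thesis using twinD[OF twin_const[OF 2(2,1)]] by simp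
    qed
  qed
  moreover have "(\<lambda>i. (\<lambda>i. if fst i then f (snd i) else f' (snd i)) (\<not> fst i, snd i)) = (\<lambda>i. if fst i then f' (snd i) else f (snd i))"
    by auto
  ultimately show "(\<lambda>i. if fst i then f' (snd i) else f (snd i)) \<in> Pol (twin_gens A)"
    by simp
qed

lemma twin_funpow: "twin f f' \<Longrightarrow> twin (f ^^ n) (f' ^^ n)"
proof (induction n)
  case 0 then show ?case using twin_id by (simp add: id_def)
next
  case (Suc n) then show ?case using twin_comp[of f f' "f ^^ n" "f' ^^ n"] by (simp add: comp_def)
qed

lemma twin_subst:
  assumes "F \<in> Pol G" and "\<And>g. g \<in> G \<Longrightarrow> twin (\<lambda>x. g (u x)) (\<lambda>x. g (u' x))"
  shows "twin (\<lambda>x. F (u x)) (\<lambda>x. F (u' x))"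
proof (rule twinI)
  have "(\<lambda>i. F (if fst i then u (snd i) else u' (snd i))) \<in> Pol (twin_gens A)"
    by (rule pol_subst[OF assms(1)]) (use twinD[OF assms(2)] in \<open>simp add: if_distrib cong: if_cong\<close>)
  then show "(\<lambda>i. if fst i then F (u (snd i)) else F (u' (snd i))) \<in> Pol (twin_gens A)"
    by (simp add: if_distrib cong: if_cong)
qed

lemma twin_col_subst:
  assumes "F \<in> Pol (col_gens A J)" and "\<And>p. p \<in> cols A J \<Longrightarrow> twin (\<lambda>x. u x p) (\<lambda>x. u' x p)"
  shows "twin (\<lambda>x. F (u x)) (\<lambda>x. F (u' x))"
  by (rule twin_subst[OF assms(1)]) (use assms(2) in \<open>auto simp: col_gens_def\<close>)

lemma twin_closed:
  assumes "twin f f'" "x \<in> A" shows "f x \<in> A" "f' x \<in> A"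
proof -
  have g: "g (b, x) \<in> A" if "g \<in> twin_gens A" for g b
    using that assms(2) by (auto simp: twin_gens_def)
  have "(\<lambda>i. if fst i then f (snd i) else f' (snd i)) (b, x) \<in> A" for b
    by (rule Pol_closed[OF twinD[OF assms(1)]]) (rule g)
  from this[of True] this[of False] show "f x \<in> A" "f' x \<in> A" by simp_all
qed

lemma twin_lcs:
  assumes "twin f f'" "(x, y) \<in> lcs k" shows "(f x, f y) \<in> lcs k"
proof -
  have "(g (True, x), g (True, y)) \<in> lcs k" if "g \<in> twin_gens A" for g
    using that assms(2) by (auto simp: twin_gens_def lcs_refl)
  then have "((\<lambda>i. if fst i then f (snd i) else f' (snd i)) (True, x),
      (\<lambda>i. if fst i then f (snd i) else f' (snd i)) (True, y)) \<in> lcs k"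
    by (rule Pol_congruence[OF lcs_congruence twinD[OF assms(1)]])
  then show ?thesis by simp
qed

text \<open>A fixed enumeration of all pairs of parameters serves every twin pair at once, so that
  no merging of parameter lists is needed.\<close>

lemma twin_term:
  assumes "h \<in> Pol (twin_gens A)" "set L = A \<times> A"
  shows "\<exists>t \<in> term_ops ar ops (length L + 1).
    \<forall>x. h (True, x) = t (map fst L @ [x]) \<and> h (False, x) = t (map snd L @ [x])"
  using assms(1)
proof induction
  case (gen h)
  then consider "h = snd" | c c' where "c \<in> A" "c' \<in> A" "h = (\<lambda>(b, x). if b then c else c')"
    by (auto simp: twin_gens_def)
  then show ?case
  proof cases
    case 1
    then show ?thesis
      by (intro bexI[of _ "\<lambda>xs. xs ! length L"] term_ops.proj) (auto simp: nth_append)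
  next
    case 2
    then obtain i where "i < length L" "L ! i = (c, c')"
      using assms(2) by (metis SigmaI in_set_conv_nth)
    then show ?thesis using 2
      by (intro bexI[of _ "\<lambda>xs. xs ! i"] term_ops.proj) (auto simp: nth_append)
  qed
next
  case (const c)
  then obtain i where "i < length L" "L ! i = (c, c)"
    using assms(2) by (metis SigmaI in_set_conv_nth)
  then show ?case
    by (intro bexI[of _ "\<lambda>xs. xs ! i"] term_ops.proj) (auto simp: nth_append)
next
  case (app gs f)
  then obtain T where T: "\<And>g. g \<in> set gs \<Longrightarrow> T g \<in> term_ops ar ops (length L + 1) \<and>
    (\<forall>x. g (True, x) = T g (map fst L @ [x]) \<and> g (False, x) = T g (map snd L @ [x]))"
    by metis
  have "(\<lambda>xs. ops f (map (\<lambda>g. g xs) (map T gs))) \<in> term_ops ar ops (length L + 1)"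
    using app(1) T by (intro term_ops.app) auto
  then show ?case
    by (rule rev_bexI) (use T in \<open>auto intro!: arg_cong[where f = "ops f"]\<close>)
qed

text \<open>Centrality enters here: passing from \<open>map fst L\<close> to
  \<open>map snd L\<close> changes the parameters arbitrarily, as the total relation on the left of
  the commutator permits, while \<open>x\<close> and \<open>y\<close> form the pair from
  \<open>lcs k\<close>.\<close>

lemma twin_central:
  assumes "twin f f'" "(x, y) \<in> lcs k" "(f x, f y) \<in> lcs (Suc k)"
  shows "(f' x, f' y) \<in> lcs (Suc k)"
proof -
  obtain L where L: "set L = A \<times> A" using fin finite_list[of "A \<times> A"] by auto
  from twin_term[OF twinD[OF assms(1)] L] obtain t where t: "t \<in> term_ops ar ops (length L + 1)"
    "\<And>x. f x = t (map fst L @ [x])" "\<And>x. f' x = t (map snd L @ [x])" by auto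
  have "list_all2 (\<lambda>a b. (a, b) \<in> A \<times> A) (map fst L) (map snd L)"
    using L nth_mem by (fastforce simp: list_all2_conv_all_nth)
  moreover have "list_all2 (\<lambda>c d. (c, d) \<in> lcs k) [x] [y]" using assms(2) by simp
  moreover have "(t (map fst L @ [x]), t (map fst L @ [y])) \<in> lcs (Suc k)"
    using assms(3) by (simp only: t(2))
  ultimately have "(t (map snd L @ [x]), t (map snd L @ [y])) \<in> lcs (Suc k)"
    using t(1) lcs_centralizes[of k, unfolded centralizes_def, rule_format,
      of t "length L" 1 "map fst L" "map snd L" "[x]" "[y]"] by (simp only: length_map, simp)
  then show ?thesis by (simp add: t)
qed

text \<open>\<open>f ^^ (N - 1)\<close> inverts \<open>f\<close> on \<open>V\<close> and, being
  polynomial, preserves \<open>lcs k\<close>.\<close>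

lemma perm_lcs_cancel:
  assumes "twin f f'" "V \<subseteq> A" "f ` V \<subseteq> V" "inj_on f V" "x \<in> V" "y \<in> V" "(f x, f y) \<in> lcs k"
  shows "(x, y) \<in> lcs k"
proof -
  have V: "finite V" "card V \<le> card A" using assms(2) fin by (auto intro: finite_subset card_mono)
  have "((f ^^ (N - 1)) (f x), (f ^^ (N - 1)) (f y)) \<in> lcs k"
    using twin_lcs[OF twin_funpow[OF assms(1)] assms(7)] .
  moreover have "(f ^^ (N - 1)) (f z) = z" if "z \<in> V" for z
    by (rule funpow_fact_solve(2)[OF V assms(3,4) that])
  ultimately show ?thesis using assms(5,6) by simp
qed

text \<open>In each factor of the series the equality \<open>f' x = f' y\<close> is carried over to
  \<open>f\<close> by centrality and cancelled there by the inverse of \<open>f\<close>.\<close>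

lemma twin_inj:
  assumes "twin f f'" "V \<subseteq> A" "f ` V \<subseteq> V" "inj_on f V"
  shows "inj_on f' V"
proof (rule inj_onI)
  fix x y assume xy: "x \<in> V" "y \<in> V" "f' x = f' y"
  show "x = y"
  proof (rule eq_by_lcs)
    fix k assume k: "(x, y) \<in> lcs k"
    have "(f' x, f' y) \<in> lcs (Suc k)"
      using xy assms(2) twin_closed(2)[OF assms(1)] lcs_refl by (metis subsetD)
    then have "(f x, f y) \<in> lcs (Suc k)" using twin_central[OF twin_sym[OF assms(1)] k] by blast
    then show "(x, y) \<in> lcs (Suc k)" by (rule perm_lcs_cancel[OF assms xy(1,2)])
  qed (use xy assms in auto)
qed

lemma subset_carrier_finite: "V \<subseteq> A \<Longrightarrow> finite V" "V \<subseteq> A \<Longrightarrow> card V \<le> card A"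
  using fin by (auto intro: finite_subset card_mono)

lemma twin_lcs_transfer:
  assumes "twin f f'" "(x, y) \<in> lcs k"
  shows "(f x, f y) \<in> lcs (Suc k) \<longleftrightarrow> (f' x, f' y) \<in> lcs (Suc k)"
  using twin_central assms twin_sym by blast

section \<open>Closure of polynomials under substitution and iteration\<close>

lemma twin_Pol3:
  assumes "q \<in> Pol gens3" "twin f1 f1'" "twin f2 f2'" "twin f3 f3'"
  shows "twin (\<lambda>x. q (f1 x, f2 x, f3 x)) (\<lambda>x. q (f1' x, f2' x, f3' x))"
  by (rule twin_subst[OF assms(1)]) (use assms(2-) in auto)

lemma Pol3_subst:
  assumes "q \<in> Pol gens3" "f1 \<in> Pol H" "f2 \<in> Pol H" "f3 \<in> Pol H"
  shows "(\<lambda>j. q (f1 j, f2 j, f3 j)) \<in> Pol H"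
  by (rule pol_subst[OF assms(1)]) (use assms(2-) in auto)

lemma Pol2_subst:
  assumes "q \<in> Pol gens2" "f1 \<in> Pol H" "f2 \<in> Pol H"
  shows "(\<lambda>j. q (f1 j, f2 j)) \<in> Pol H"
  by (rule pol_subst[OF assms(1)]) (use assms(2-) in auto)

lemma Pol1_subst:
  assumes "g \<in> Pol {\<lambda>x. x}" "f \<in> Pol H"
  shows "(\<lambda>j. g (f j)) \<in> Pol H"
  by (rule pol_subst[OF assms(1)]) (use assms(2-) in auto)

lemma Pol1_funpow: "g \<in> Pol {\<lambda>x. x} \<Longrightarrow> (g ^^ n) \<in> Pol {\<lambda>x. x}"
proof (induction n)
  case 0 then show ?case using pol.gen[of "\<lambda>x. x" "{\<lambda>x. x}" A ar ops] by (simp add: id_def)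
next
  case (Suc n) then show ?case using Pol1_subst[of g "g ^^ n"] by (simp add: comp_def)
qed

text \<open>Used with \<open>n = N - 1\<close>, this makes the solution of an equation polynomial in
  its right-hand side and its parameter.\<close>

lemma Pol2_funpow:
  assumes "q \<in> Pol gens2" "f1 \<in> Pol H" "f2 \<in> Pol H"
  shows "(\<lambda>j. ((\<lambda>u. q (u, f2 j)) ^^ n) (f1 j)) \<in> Pol H"
proof (induction n)
  case (Suc n)
  then show ?case using Pol2_subst[OF assms(1) Suc assms(3)] by simp
qed (use assms in simp)

lemma Pol1_twin: "g \<in> Pol {\<lambda>x. x} \<Longrightarrow> twin g g"
  using twin_subst[of g "{\<lambda>x. x}" "\<lambda>x. x" "\<lambda>x. x"] twin_id by simp

text \<open>\<open>s x\<close> is the unique \<open>u\<close> in \<open>E ` A\<close> with \<open>E (Q u x) = E (Q x x)\<close>. Injectivity is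
  lifted along the lower central series: first \<open>E x\<close> and \<open>E y\<close>, then \<open>s x\<close> and \<open>s y\<close>,
  finally \<open>x\<close> and \<open>y\<close> are shown to be congruent.\<close>

lemma inj_corrected_diagonal:
  fixes Q :: "'a \<Rightarrow> 'a \<Rightarrow> 'a" and g i :: "'a \<Rightarrow> 'a"
  defines "E \<equiv> g ^^ N"
  defines "s \<equiv> \<lambda>x. ((\<lambda>u. E (Q u x)) ^^ (N - 1)) (E (Q x x))"
  assumes VA: "V \<subseteq> A"
    and "\<forall>w\<in>A. \<forall>x\<in>A. Q w x \<in> V"
    and "\<forall>x\<in>A. g x \<in> V"
    and gg: "twin g g"
    and "twin (\<lambda>x. Q x x) i" "\<forall>x\<in>V. i x = x"
    and "\<forall>x\<in>A. twin (\<lambda>w. Q w x) g"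
    and "\<forall>u\<in>A. \<forall>u'\<in>A. twin (Q u) (Q u')"
  shows "\<And>x. x \<in> A \<Longrightarrow> s x \<in> E ` A"
    and "\<And>x. x \<in> A \<Longrightarrow> E (Q (s x) x) = E (Q x x)"
    and "\<And>x. x \<in> A \<Longrightarrow> inj_on (\<lambda>u. E (Q u x)) (E ` A)"
    and "inj_on (\<lambda>x. Q (s x) x) V"
proof -
  have QV: "\<And>w x. w \<in> A \<Longrightarrow> x \<in> A \<Longrightarrow> Q w x \<in> V"
    and gV: "\<And>x. x \<in> A \<Longrightarrow> g x \<in> V"
    and diag: "twin (\<lambda>x. Q x x) i" "\<And>x. x \<in> V \<Longrightarrow> i x = x"
    and left: "\<And>x. x \<in> A \<Longrightarrow> twin (\<lambda>w. Q w x) g"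
    and right: "\<And>u u'. u \<in> A \<Longrightarrow> u' \<in> A \<Longrightarrow> twin (Q u) (Q u')"
    using assms by auto
  let ?U = "E ` A"
  have gA: "g ` A \<subseteq> A" using gV VA by auto
  have EA: "E x \<in> A" if "x \<in> A" for x
    unfolding E_def by (rule funpow_image_subset[OF gA that])
  have UA: "?U \<subseteq> A" using EA by auto
  have idem: "E (E x) = E x" if "x \<in> A" for x
    unfolding E_def by (rule funpow_fact_idem[OF fin le_refl gA that])
  have EU: "E u = u" if "u \<in> ?U" for u using that idem by auto
  have comm: "g (E x) = E (g x)" for x unfolding E_def by (rule funpow_swap1)
  have gU: "g ` ?U \<subseteq> ?U" using comm gA by auto
  \<comment> \<open>\<open>E\<close> factors through \<open>g\<close> and fixes \<open>?U\<close>
    pointwise.\<close>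
  have g_inj: "inj_on g ?U"
  proof (rule inj_onI)
    fix u v assume uv: "u \<in> ?U" "v \<in> ?U" "g u = g v"
    have "E z = (g ^^ (N - 1)) (g z)" for z
      unfolding E_def using funpow_Suc_right[of "N - 1" g] by (simp add: fun_eq_iff)
    then have "E u = E v" using uv(3) by metis
    then show "u = v" using EU[OF uv(1)] EU[OF uv(2)] by simp
  qed
  have EE: "twin E E" unfolding E_def by (rule twin_funpow[OF gg])
  have EQ_U: "E (Q w x) \<in> ?U" if "w \<in> A" "x \<in> A" for w x using QV[OF that] VA by auto
  \<comment> \<open>Freezing the second argument of \<open>Q\<close> gives a twin of
    \<open>g\<close>, and after \<open>E\<close> a twin of a permutation of \<open>?U\<close>; this
    makes the equation for \<open>s x\<close> uniquely solvable.\<close>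
  have EQ_twin: "twin (\<lambda>w. E (g w)) (\<lambda>w. E (Q w x))" if "x \<in> A" for x
    using twin_comp[OF EE twin_sym[OF left[OF that]]] .
  have Eg: "(\<lambda>w. E (g w)) ` ?U \<subseteq> ?U" "inj_on (\<lambda>w. E (g w)) ?U"
  proof -
    have *: "E (g w) = g w" if "w \<in> ?U" for w using that gU EU by blast
    show "(\<lambda>w. E (g w)) ` ?U \<subseteq> ?U" using gU * by auto
    show "inj_on (\<lambda>w. E (g w)) ?U" using g_inj * by (simp add: inj_on_def)
  qed
  have EQ_inj: "inj_on (\<lambda>w. E (Q w x)) ?U" if "x \<in> A" for x
    by (rule twin_inj[OF EQ_twin[OF that] UA Eg])
  then show "\<And>x. x \<in> A \<Longrightarrow> inj_on (\<lambda>u. E (Q u x)) ?U" .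
  have EQ_img: "(\<lambda>w. E (Q w x)) ` ?U \<subseteq> ?U" if "x \<in> A" for x using EQ_U UA that by blast
  show sU: "s x \<in> ?U" if "x \<in> A" for x
    unfolding s_def by (rule funpow_image_subset[OF EQ_img[OF that] EQ_U[OF that that]])
  show sQ: "E (Q (s x) x) = E (Q x x)" if "x \<in> A" for x
    unfolding s_def
    by (rule funpow_fact_solve(1)[OF subset_carrier_finite[OF UA] EQ_img[OF that] EQ_inj[OF that] EQ_U[OF that that]])
  have i_V: "i ` V \<subseteq> V" "inj_on i V" using diag(2) by (auto simp: inj_on_def)
  \<comment> \<open>\<open>?\<pi>\<close> is a twin of \<open>i\<close>, which is the identity on
    \<open>V\<close>; hence it permutes \<open>V\<close>, with inverse
    \<open>?\<rho>\<close>.\<close>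
  let ?\<pi> = "\<lambda>x. Q x x"
  have pi_V: "?\<pi> ` V \<subseteq> V" using QV VA by auto
  have pi_inj: "inj_on ?\<pi> V" by (rule twin_inj[OF twin_sym[OF diag(1)] VA i_V])
  let ?\<rho> = "?\<pi> ^^ (N - 1)"
  have rho: "?\<rho> (?\<pi> z) = z" if "z \<in> V" for z
    by (rule funpow_fact_solve(2)[OF subset_carrier_finite[OF VA] pi_V pi_inj that])
  have i_pow: "(i ^^ n) z = z" if "z \<in> V" for n z using that diag(2) by (induction n) auto
  show "inj_on (\<lambda>x. Q (s x) x) V"
  proof (rule inj_onI)
    fix x y assume V: "x \<in> V" "y \<in> V" and eq: "Q (s x) x = Q (s y) y"
    have A: "x \<in> A" "y \<in> A" "s x \<in> A" "s y \<in> A" using V VA sU UA by auto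
    show "x = y"
    proof (rule eq_by_lcs[OF A(1,2)])
      fix k assume k: "(x, y) \<in> lcs k"
      let ?R = "lcs (Suc k)"
      \<comment> \<open>Applying \<open>E\<close> to \<open>eq\<close> and using the equation solved
        by \<open>s\<close> removes the correction.\<close>
      have pi: "E (?\<pi> x) = E (?\<pi> y)" using sQ[OF A(1)] sQ[OF A(2)] eq by simp
      have refl: "(z, z) \<in> ?R" if "z \<in> A" for z using that by (rule lcs_refl)
      have EQA: "E (Q u z) \<in> A" if "u \<in> A" "z \<in> A" for u z using EQ_U[OF that] UA by auto
      have "(E (?\<pi> x), E (?\<pi> y)) \<in> ?R" using pi EQA A refl by simp
      then have "(E (i x), E (i y)) \<in> ?R"
        using twin_lcs_transfer[OF twin_comp[OF EE diag(1)] k] by simp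
      then have Exy: "(E x, E y) \<in> ?R" using diag(2) V by simp
      then have "(E (g x), E (g y)) \<in> ?R" using twin_lcs[OF gg] comm by metis
      then have "(E (Q x y), E (Q y y)) \<in> ?R"
        using twin_lcs_transfer[OF EQ_twin[OF A(2)] k] by simp
      then have "(E (Q x x), E (Q x y)) \<in> ?R" using pi lcs_sym by simp
      then have "(E (Q (s y) x), E (Q (s y) y)) \<in> ?R"
        using twin_lcs_transfer[OF twin_comp[OF EE right[OF A(1,4)]] k] by simp
      then have "(E (Q (s x) x), E (Q (s y) x)) \<in> ?R"
        using eq lcs_sym by simp
      then have "(s x, s y) \<in> ?R"
        using perm_lcs_cancel[OF twin_sym[OF EQ_twin[OF A(1)]] UA EQ_img[OF A(1)] EQ_inj[OF A(1)] sU[OF A(1)] sU[OF A(2)]]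
        by blast
      then have "(Q (s x) y, Q (s y) y) \<in> ?R" using twin_lcs[OF left[OF A(2)]] by blast
      then have "(Q (s x) x, Q (s x) y) \<in> ?R" using eq lcs_sym by simp
      then have "(Q x x, Q x y) \<in> ?R"
        using twin_lcs_transfer[OF right[OF A(3,1)] k] by simp
      then have gam1: "(x, ?\<rho> (Q x y)) \<in> ?R"
        using twin_lcs[OF twin_funpow[OF diag(1)], of "Q x x" "Q x y" "Suc k" "N - 1"] rho[OF V(1)] by simp
      \<comment> \<open>\<open>\<gamma>\<close> fixes \<open>y\<close>, moves \<open>x\<close> only
        within its class, and is a twin of a map whose \<open>N\<close>-th power agrees with
        \<open>E\<close> on \<open>A\<close>. Since \<open>E x\<close> and \<open>E y\<close> are
        congruent, so are the \<open>N\<close>-th iterates of \<open>\<gamma>\<close> at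
        \<open>x\<close> and \<open>y\<close>.\<close>
      define \<gamma> where "\<gamma> = (\<lambda>w. ?\<rho> (Q w y))"
      have gamma: "twin \<gamma> (\<lambda>w. (i ^^ (N - 1)) (g w))"
        unfolding \<gamma>_def by (rule twin_comp[OF twin_funpow[OF diag(1)] left[OF A(2)]])
      have gamx: "(x, (\<gamma> ^^ n) x) \<in> ?R" for n
      proof (induction n)
        case (Suc n)
        have "(\<gamma> x, \<gamma> ((\<gamma> ^^ n) x)) \<in> ?R" by (rule twin_lcs[OF gamma Suc])
        then show ?case using gam1 lcs_trans by (auto simp: \<gamma>_def)
      qed (use refl A in simp)
      have "\<gamma> y = y" unfolding \<gamma>_def by (rule rho[OF V(2)])
      then have gamy: "(\<gamma> ^^ n) y = y" for n by (induction n) auto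
      have "((\<lambda>w. (i ^^ (N - 1)) (g w)) ^^ n) z = (g ^^ n) z" if "z \<in> A" for n z
      proof (induction n)
        case (Suc n)
        then show ?case using i_pow gV funpow_image_subset[OF gA that] by simp
      qed simp
      then have "(((\<lambda>w. (i ^^ (N - 1)) (g w)) ^^ N) x, ((\<lambda>w. (i ^^ (N - 1)) (g w)) ^^ N) y) \<in> ?R"
        using Exy A by (simp add: E_def)
      then have "((\<gamma> ^^ N) x, (\<gamma> ^^ N) y) \<in> ?R"
        using twin_lcs_transfer[OF twin_funpow[OF gamma] k] by blast
      then show "(x, y) \<in> ?R" using gamx gamy lcs_trans by metis
    qed
  qed
qed

section \<open>Maltsev polynomials on ranges\<close>

definition maltsev_on :: "'a set \<Rightarrow> bool" where
  "maltsev_on V \<longleftrightarrow> (\<exists>m \<in> Pol gens3. \<forall>x\<in>V. \<forall>y\<in>V. m (x, y, y) = x \<and> m (y, y, x) = x)"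

text \<open>By centrality every translation of \<open>p\<close> is a permutation of \<open>V\<close>, so \<open>p\<close> is a quasigroup
  operation on \<open>V\<close>; its divisions are iterates of translations, and
  \<open>(x / (y \ y)) (y \ z)\<close> is a Maltsev operation.\<close>

lemma maltsev_on_quasigroup:
  assumes p: "p \<in> Pol gens2" and VA: "V \<subseteq> A" and oA: "o' \<in> A"
    and pV: "\<And>x y. x \<in> A \<Longrightarrow> y \<in> A \<Longrightarrow> p (x, y) \<in> V"
    and inj: "inj_on (\<lambda>x. p (x, o')) V" "inj_on (\<lambda>y. p (o', y)) V"
  shows "maltsev_on V"
proof -
  have img: "(\<lambda>x. p (x, y)) ` V \<subseteq> V" "(\<lambda>x. p (y, x)) ` V \<subseteq> V" if "y \<in> A" for y
    using pV VA that by auto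
  have tw: "twin (\<lambda>x. p (x, o')) (\<lambda>x. p (x, y))" "twin (\<lambda>x. p (o', x)) (\<lambda>x. p (y, x))"
    if "y \<in> A" for y
    by (rule twin_subst[OF p]; use twin_id twin_const that oA in force)+
  have injs: "inj_on (\<lambda>x. p (x, y)) V" "inj_on (\<lambda>x. p (y, x)) V" if "y \<in> A" for y
    by (rule twin_inj[OF tw(1)[OF that] VA img(1)[OF oA] inj(1)],
        rule twin_inj[OF tw(2)[OF that] VA img(2)[OF oA] inj(2)])
  \<comment> \<open>Swapping the arguments lets \<open>Pol2_funpow\<close>, which iterates in the
    first one, handle \<open>ld\<close> too.\<close>
  let ?p' = "\<lambda>z. p (snd z, fst z)"
  define rd where "rd x y = ((\<lambda>u. p (u, y)) ^^ (N - 1)) x" for x y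
  define ld where "ld x y = ((\<lambda>u. p (x, u)) ^^ (N - 1)) y" for x y
  have rd: "p (rd x y, y) = x" "rd (p (x, y)) y = x" if "x \<in> V" "y \<in> V" for x y
  proof -
    have "y \<in> A" using that VA by blast
    from funpow_fact_solve[OF subset_carrier_finite[OF VA] img(1)[OF this] injs(1)[OF this] that(1)]
    show "p (rd x y, y) = x" "rd (p (x, y)) y = x" unfolding rd_def .
  qed
  have ld: "p (x, ld x y) = y" "ld x y \<in> V" if "x \<in> V" "y \<in> V" for x y
  proof -
    have x: "x \<in> A" using that VA by blast
    show "p (x, ld x y) = y"
      unfolding ld_def
      by (rule funpow_fact_solve(1)[OF subset_carrier_finite[OF VA] img(2)[OF x] injs(2)[OF x] that(2)])
    show "ld x y \<in> V" unfolding ld_def by (rule funpow_image_subset[OF img(2)[OF x] that(2)])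
  qed
  have p': "?p' \<in> Pol gens2" by (rule Pol2_subst[OF p]) (auto intro: pol.gen)
  have ld_Pol: "(\<lambda>j. ld (f1 j) (f2 j)) \<in> Pol gens3" if "f1 \<in> Pol gens3" "f2 \<in> Pol gens3" for f1 f2
    using Pol2_funpow[OF p' that(2,1), of "N - 1"] unfolding ld_def by simp
  have rd_Pol: "(\<lambda>j. rd (f1 j) (f2 j)) \<in> Pol gens3" if "f1 \<in> Pol gens3" "f2 \<in> Pol gens3" for f1 f2
    using Pol2_funpow[OF p that, of "N - 1"] unfolding rd_def .
  let ?x = "fst" and ?y = "\<lambda>x. fst (snd x)" and ?z = "\<lambda>x. snd (snd x)"
  let ?m = "\<lambda>j. p (rd (?x j) (ld (?y j) (?y j)), ld (?y j) (?z j))"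
  have f3: "?x \<in> Pol gens3" "?y \<in> Pol gens3" "?z \<in> Pol gens3" by (auto intro: pol.gen)
  have "?m \<in> Pol gens3"
    by (rule Pol2_subst[OF p rd_Pol[OF f3(1) ld_Pol[OF f3(2,2)]] ld_Pol[OF f3(2,3)]])
  \<comment> \<open>With \<open>e = ld y y\<close>, the first identity is
    \<open>p (rd x e, e) = x\<close>; for the second, \<open>p (y, e) = y\<close> gives
    \<open>rd y e = y\<close>.\<close>
  moreover have "?m (x, y, y) = x \<and> ?m (y, y, x) = x" if "x \<in> V" "y \<in> V" for x y
    using rd(1)[OF that(1) ld(2)[OF that(2,2)]] rd(2)[OF that(2) ld(2)[OF that(2,2)]]
      ld(1)[OF that(2,2)] ld(1)[OF that(2,1)] by simp
  ultimately show ?thesis unfolding maltsev_on_def by (intro bexI[of _ ?m] ballI)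
qed

text \<open>\<open>m\<close> joins the two corrections: since \<open>s o' = t o'\<close>, the first
  argument of \<open>q\<close> in \<open>?p\<close> collapses to \<open>s x\<close> when
  \<open>y = o'\<close> and to \<open>t y\<close> when \<open>x = o'\<close>. Both translations of
  \<open>?p\<close> at \<open>o'\<close> are then injective by
  \<open>inj_corrected_diagonal\<close>.\<close>

lemma maltsev_on_extend:
  fixes q :: "'a \<times> 'a \<times> 'a \<Rightarrow> 'a" and g i i' :: "'a \<Rightarrow> 'a"
  assumes q: "q \<in> Pol gens3" and g: "g \<in> Pol {\<lambda>x. x}" and VA: "V \<subseteq> A" and oA: "o' \<in> A"
    and qV: "\<And>w x y. w \<in> A \<Longrightarrow> x \<in> A \<Longrightarrow> y \<in> A \<Longrightarrow> q (w, x, y) \<in> V"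
    and gV: "\<And>x. x \<in> A \<Longrightarrow> g x \<in> V"
    and diag: "twin (\<lambda>x. q (x, x, o')) i" "\<And>x. x \<in> V \<Longrightarrow> i x = x"
    and diag': "twin (\<lambda>x. q (x, o', x)) i'" "\<And>x. x \<in> V \<Longrightarrow> i' x = x"
    and left: "\<And>x y. x \<in> A \<Longrightarrow> y \<in> A \<Longrightarrow> twin (\<lambda>w. q (w, x, y)) g"
    and malt: "maltsev_on ((g ^^ N) ` A)"
  shows "maltsev_on V"
proof -
  define E where "E = g ^^ N"
  define s where "s x = ((\<lambda>u. E (q (u, x, o'))) ^^ (N - 1)) (E (q (x, x, o')))" for x
  define t where "t x = ((\<lambda>u. E (q (u, o', x))) ^^ (N - 1)) (E (q (x, o', x)))" for x
  have tw: "twin (\<lambda>x. q (u, x, o')) (\<lambda>x. q (u', x, o'))" "twin (\<lambda>x. q (u, o', x)) (\<lambda>x. q (u', o', x))"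
    if "u \<in> A" "u' \<in> A" for u u'
    by (intro twin_Pol3[OF q] twin_id twin_const that oA)+
  have S: "\<And>x. x \<in> A \<Longrightarrow> s x \<in> E ` A"
    "\<And>x. x \<in> A \<Longrightarrow> E (q (s x, x, o')) = E (q (x, x, o'))"
    "\<And>x. x \<in> A \<Longrightarrow> inj_on (\<lambda>u. E (q (u, x, o'))) (E ` A)"
    "inj_on (\<lambda>x. q (s x, x, o')) V"
    using inj_corrected_diagonal[of V "\<lambda>w x. q (w, x, o')" g i] VA qV gV Pol1_twin[OF g] diag left tw(1) oA
    unfolding E_def s_def by simp_all
  have T: "\<And>x. x \<in> A \<Longrightarrow> t x \<in> E ` A"
    "\<And>x. x \<in> A \<Longrightarrow> E (q (t x, o', x)) = E (q (x, o', x))"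
    "\<And>x. x \<in> A \<Longrightarrow> inj_on (\<lambda>u. E (q (u, o', x))) (E ` A)"
    "inj_on (\<lambda>x. q (t x, o', x)) V"
    using inj_corrected_diagonal[of V "\<lambda>w x. q (w, o', x)" g i'] VA qV gV Pol1_twin[OF g] diag' left tw(2) oA
    unfolding E_def t_def by simp_all
  \<comment> \<open>Both values lie in the range of \<open>E\<close> and solve
    \<open>E (q (u, o', o')) = E (q (o', o', o'))\<close>, whose solution there is unique.\<close>
  have st: "t o' = s o'"
    using inj_onD[OF S(3)[OF oA]] S(1,2)[OF oA] T(1,2)[OF oA] by metis
  obtain m where m: "m \<in> Pol gens3" "\<And>x y. x \<in> E ` A \<Longrightarrow> y \<in> E ` A \<Longrightarrow> m (x, y, y) = x \<and> m (y, y, x) = x"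
    using malt unfolding maltsev_on_def E_def by blast
  let ?p = "\<lambda>z. q (m (s (fst z), s o', t (snd z)), fst z, snd z)"
  have E: "E \<in> Pol {\<lambda>x. x}" unfolding E_def by (rule Pol1_funpow[OF g])
  have fs: "fst \<in> Pol gens2" "snd \<in> Pol gens2" by (auto intro: pol.gen)
  have oP: "(\<lambda>j. o') \<in> Pol G" for G :: "('i \<Rightarrow> 'a) set" by (rule pol.const[OF oA])
  have q1: "(\<lambda>z. E (q (fst z, snd z, o'))) \<in> Pol gens2" "(\<lambda>z. E (q (fst z, o', snd z))) \<in> Pol gens2"
    by (intro Pol1_subst[OF E] Pol3_subst[OF q] fs oP)+
  have s_Pol: "(\<lambda>j. s (fst j)) \<in> Pol gens2"
    using Pol2_funpow[OF q1(1) _ fs(1), of "\<lambda>z. E (q (fst z, fst z, o'))" "N - 1"]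
      Pol1_subst[OF E Pol3_subst[OF q fs(1) fs(1) oP]] by (simp add: s_def)
  have t_Pol: "(\<lambda>j. t (snd j)) \<in> Pol gens2"
    using Pol2_funpow[OF q1(2) _ fs(2), of "\<lambda>z. E (q (snd z, o', snd z))" "N - 1"]
      Pol1_subst[OF E Pol3_subst[OF q fs(2) oP fs(2)]] by (simp add: t_def)
  have UA: "E ` A \<subseteq> A" using funpow_image_subset[of g A] gV VA unfolding E_def by blast
  have so: "s o' \<in> E ` A" by (rule S(1)[OF oA])
  have "?p \<in> Pol gens2"
    using so UA by (intro Pol3_subst[OF q] Pol3_subst[OF m(1)] s_Pol t_Pol fs pol.const) auto
  moreover have "?p (x, y) \<in> V" if "x \<in> A" "y \<in> A" for x y
  proof -
    have "s x \<in> A" "t y \<in> A" "s o' \<in> A" using S(1)[OF that(1)] T(1)[OF that(2)] so UA by blast+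
    then have "m (s x, s o', t y) \<in> A" by (intro Pol_closed[OF m(1)]) auto
    then show ?thesis using qV that by simp
  qed
  moreover have "inj_on (\<lambda>x. ?p (x, o')) V"
    using S(4) m(2)[OF S(1) so] VA by (simp add: st inj_on_def subset_eq)
  moreover have "inj_on (\<lambda>y. ?p (o', y)) V"
    using T(4) m(2)[OF T(1) so] VA by (simp add: inj_on_def subset_eq)
  ultimately show ?thesis by (intro maltsev_on_quasigroup[OF _ VA oA]) auto
qed

section \<open>Cube polynomials\<close>

text \<open>A cube polynomial with row \<open>a\<close> weakened to give \<open>f x\<close> instead
  of \<open>x\<close>. Row \<open>a\<close> is prescribed on the whole type, so that
  \<open>f\<close> is itself a polynomial function.\<close>

definition cube_row :: "nat \<Rightarrow> nat set \<Rightarrow> ('a \<Rightarrow> 'a) \<Rightarrow> bool" where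
  "cube_row a I f \<longleftrightarrow> (\<exists>F \<in> Pol (col_gens A (insert a I)).
     (\<forall>r\<in>I. \<forall>x\<in>A. F (row r x) = x) \<and> (\<forall>x. F (row a x) = f x))"

lemma col_in_Pol: "p \<in> cols A J \<Longrightarrow> (\<lambda>\<alpha>. \<alpha> p) \<in> Pol (col_gens A J)"
  unfolding col_gens_def by (rule pol.gen) blast

text \<open>Substituting \<open>F'\<close> only for the variables whose column has the distinguished variable in
  row \<open>a\<close> composes the functions of row \<open>a\<close> and keeps the identity in the other rows.\<close>

lemma cube_row_comp:
  assumes "cube_row a I f" "cube_row a I' f'" "I' \<subseteq> I"
  shows "cube_row a I' (\<lambda>x. f (f' x))"
proof -
  obtain F where F: "F \<in> Pol (col_gens A (insert a I))"
    "\<And>r x. r \<in> I \<Longrightarrow> x \<in> A \<Longrightarrow> F (row r x) = x" "\<And>x. F (row a x) = f x"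
    using assms(1) unfolding cube_row_def by auto
  obtain F' where F': "F' \<in> Pol (col_gens A (insert a I'))"
    "\<And>r x. r \<in> I' \<Longrightarrow> x \<in> A \<Longrightarrow> F' (row r x) = x" "\<And>x. F' (row a x) = f' x"
    using assms(2) unfolding cube_row_def by auto
  \<comment> \<open>The column \<open>q\<close> with its distinguished variable replaced, row by
    row, by the entry of \<open>p\<close>.\<close>
  define meet :: "nat set \<times> (nat \<Rightarrow> 'a) \<Rightarrow> nat set \<times> (nat \<Rightarrow> 'a) \<Rightarrow> nat set \<times> (nat \<Rightarrow> 'a)"
    where "meet p q = (fst p \<inter> fst q, \<lambda>r. if r \<in> fst q then snd p r else snd q r)" for p q
  define u where "u \<alpha> p = (if a \<in> fst p then F' (\<lambda>q. \<alpha> (meet p q))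
      else \<alpha> (fst p \<inter> insert a I', snd p))" for \<alpha> :: "nat set \<times> (nat \<Rightarrow> 'a) \<Rightarrow> 'a" and p
  have meet_cols: "meet p q \<in> cols A (insert a I')"
    if "p \<in> cols A (insert a I)" "q \<in> cols A (insert a I')" for p q
    using that by (auto simp: meet_def cols_def)
  have u_Pol: "(\<lambda>\<alpha>. u \<alpha> p) \<in> Pol (col_gens A (insert a I'))" if p: "p \<in> cols A (insert a I)" for p
  proof (cases "a \<in> fst p")
    case True
    have "(\<lambda>\<alpha>. F' (\<lambda>q. \<alpha> (meet p q))) \<in> Pol (col_gens A (insert a I'))"
      by (rule pol_col_subst[OF F'(1)]) (rule col_in_Pol[OF meet_cols[OF p]])
    then show ?thesis using True by (simp add: u_def)
  next
    case False
    \<comment> \<open>Restricted to fewer rows, the column stays proper because it still misses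
      \<open>a\<close>.\<close>
    then have "(fst p \<inter> insert a I', snd p) \<in> cols A (insert a I')"
      using p by (auto simp: cols_def)
    from col_in_Pol[OF this] show ?thesis using False by (simp add: u_def)
  qed
  have row_meet: "(\<lambda>q. row r x (meet p q)) = row r (row r x p)" for r x p
    by (auto simp: fun_eq_iff row_def meet_def split: prod.splits)
  have u_row: "u (row r x) p = (if a \<in> fst p then F' (row r (row r x p)) else row r x p)"
    if "r \<in> insert a I'" for r x p
    using that unfolding u_def row_meet by (cases p) (auto simp: row_def)
  have "(\<lambda>\<alpha>. F (u \<alpha>)) \<in> Pol (col_gens A (insert a I'))"
    by (rule pol_col_subst[OF F(1) u_Pol])
  moreover have "F (u (row r x)) = x" if r: "r \<in> I'" and x: "x \<in> A" for r x
  proof -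
    have "u (row r x) p = row r x p" if p: "p \<in> cols A (insert a I)" for p
    proof -
      have "row r x p \<in> A" using p x by (cases p) (simp add: row_def cols_def, blast)
      then show ?thesis using F'(2)[OF r] u_row[of r] r by simp
    qed
    then have "F (u (row r x)) = F (row r x)" by (rule pol_col_cong[OF F(1)])
    then show ?thesis using F(2) r x assms(3) by auto
  qed
  moreover have "F (u (row a x)) = f (f' x)" for x
  proof -
    have "u (row a x) = row a (f' x)"
    proof
      fix p show "u (row a x) p = row a (f' x) p"
        using u_row[of a x p] F'(3)[of x] by (cases p) (auto simp: row_def)
    qed
    then show ?thesis using F(3) by simp
  qed
  ultimately show ?thesis unfolding cube_row_def by (intro bexI[of _ "\<lambda>\<alpha>. F (u \<alpha>)"]) auto
qed

text \<open>Only positive powers: the zeroth would put the identity in row \<open>a\<close>, that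
  is, be a full cube polynomial.\<close>

lemma cube_row_funpow: "cube_row a I f \<Longrightarrow> cube_row a I (f ^^ Suc n)"
proof (induction n)
  case 0 then show ?case by simp
next
  case (Suc n)
  then show ?case using cube_row_comp[of a I f I "f ^^ Suc n"] by (simp add: comp_def)
qed

text \<open>Columns remain proper when row \<open>b\<close> is dropped: one with the variable in
  both \<open>a\<close> and \<open>b\<close> misses a row of \<open>I\<close>, and any other one
  loses the variable in row \<open>a\<close>. The price is an unknown function in row
  \<open>a\<close>.\<close>

lemma cube_row_merge:
  assumes F: "F \<in> Pol (col_gens A (insert a (insert b I)))"
    "\<And>r x. r \<in> I \<Longrightarrow> x \<in> A \<Longrightarrow> F (row r x) = x" and "a \<noteq> b" "a \<notin> I" "b \<notin> I"
  shows "cube_row a I (\<lambda>x. F (\<lambda>p. if a \<in> fst p \<and> b \<in> fst p then x else snd p a))"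
proof -
  define v :: "nat set \<times> (nat \<Rightarrow> 'a) \<Rightarrow> nat set \<times> (nat \<Rightarrow> 'a)"
    where "v p = (if a \<in> fst p \<and> b \<in> fst p then fst p - {b} else fst p - {a, b}, snd p)" for p
  have "v p \<in> cols A (insert a I)" if "p \<in> cols A (insert a (insert b I))" for p
    using that assms(3-) by (auto simp: cols_def v_def)
  then have Pol: "(\<lambda>\<alpha>. F (\<lambda>p. \<alpha> (v p))) \<in> Pol (col_gens A (insert a I))"
    by (intro pol_col_subst[OF F(1)] col_in_Pol)
  have "(\<lambda>p. row r x (v p)) = row r x" if "r \<in> I" for r x
    using that assms(3-) by (auto simp: row_def fun_eq_iff v_def)
  then have row_I: "F (\<lambda>p. row r x (v p)) = x" if "r \<in> I" "x \<in> A" for r x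
    using F(2) that by simp
  have row_a: "(\<lambda>p. row a x (v p)) = (\<lambda>p. if a \<in> fst p \<and> b \<in> fst p then x else snd p a)" for x
    using assms(3-) by (auto simp: row_def fun_eq_iff v_def)
  show ?thesis
    unfolding cube_row_def by (intro bexI[OF _ Pol]) (simp add: row_I row_a)
qed

lemma cube_row_maltsev:
  assumes "finite I" "a \<notin> I" "cube_row a I e" "\<And>x. x \<in> A \<Longrightarrow> e (e x) = e x"
  shows "maltsev_on (e ` A)"
  using assms
proof (induction I arbitrary: e)
  case empty
  then obtain F where F: "F \<in> Pol (col_gens A {a})" "\<And>x. F (row a x) = e x"
    unfolding cube_row_def by auto
  \<comment> \<open>With no other row every column is constant, as a proper subset of
    \<open>{a}\<close> is empty. So the range of \<open>e\<close> is a single point.\<close>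
  have "e x = e y" for x y
  proof -
    have "F (row a x) = F (row a y)"
    proof (rule pol_col_cong[OF F(1)])
      fix p assume "p \<in> cols A {a}"
      then show "row a x p = row a y p" by (cases p) (simp add: cols_def row_def, blast)
    qed
    then show ?thesis using F(2) by simp
  qed
  then have "x = y" if "x \<in> e ` A" "y \<in> e ` A" for x y using that by fast
  then show ?case unfolding maltsev_on_def by (intro bexI[of _ fst] ballI) (auto intro: pol.gen)
next
  case (insert b I)
  have ab: "a \<noteq> b" "a \<notin> I" "b \<notin> I" using insert by auto
  obtain F where F: "F \<in> Pol (col_gens A (insert a (insert b I)))"
    "\<And>r x. r \<in> insert b I \<Longrightarrow> x \<in> A \<Longrightarrow> F (row r x) = x" "\<And>x. F (row a x) = e x"
    using insert.prems(2) unfolding cube_row_def by blast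
  \<comment> \<open>\<open>h\<close> is the function left in row \<open>a\<close> after merging;
    following it by \<open>e\<close> moves its values into the set on which a Maltsev polynomial is
    sought.\<close>
  define h where "h x = F (\<lambda>p. if a \<in> fst p \<and> b \<in> fst p then x else snd p a)" for x
  define g where "g x = e (h x)" for x
  have h: "cube_row a I h"
    unfolding h_def[abs_def] by (rule cube_row_merge[OF F(1) F(2) ab]) auto
  have "cube_row a I g"
    unfolding g_def[abs_def] by (rule cube_row_comp[OF insert.prems(2) h]) auto
  then have gN: "cube_row a I (g ^^ N)"
    using cube_row_funpow[of a I g "N - 1"] by simp
  have idP: "(\<lambda>x. x) \<in> Pol {\<lambda>x. x}" by (rule pol.gen) simp
  have pc: "snd p r \<in> A" if "p \<in> cols A J" for p r J
    using that by (cases p) (simp add: cols_def, blast)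
  have "(\<lambda>x. F (row a x)) \<in> Pol {\<lambda>x. x}"
  proof (rule pol_col_subst[OF F(1)])
    fix p assume "p \<in> cols A (insert a (insert b I))"
    from pol.const[OF pc[OF this, of a]] show "(\<lambda>x. row a x p) \<in> Pol {\<lambda>x. x}"
      using idP by (cases "a \<in> fst p") (simp_all add: row_def case_prod_beta')
  qed
  then have e: "e \<in> Pol {\<lambda>x. x}" using F(3) by simp
  have hP: "h \<in> Pol {\<lambda>x. x}"
    unfolding h_def[abs_def]
  proof (rule pol_col_subst[OF F(1)])
    fix p assume "p \<in> cols A (insert a (insert b I))"
    from pol.const[OF pc[OF this, of a]]
    show "(\<lambda>x. if a \<in> fst p \<and> b \<in> fst p then x else snd p a) \<in> Pol {\<lambda>x. x}"
      using idP by (cases "a \<in> fst p"; cases "b \<in> fst p") simp_all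
  qed
  have g: "g \<in> Pol {\<lambda>x. x}" unfolding g_def[abs_def] by (rule Pol1_subst[OF e hP])
  have eA: "e x \<in> A" and hA: "h x \<in> A" if "x \<in> A" for x
    using twin_closed(1)[OF Pol1_twin[OF e] that] twin_closed(1)[OF Pol1_twin[OF hP] that] by auto
  have ee: "twin e e" by (rule Pol1_twin[OF e])
  obtain o' where oA: "o' \<in> A" using alg unfolding is_algebra_def by auto
  \<comment> \<open>Columns with the variable in neither row receive \<open>o'\<close> instead of
    their own constants; this changes only parameters, so twins absorb it.\<close>
  define u where "u z p = (if a \<in> fst p \<and> b \<in> fst p then fst z else if a \<in> fst p then fst (snd z)
      else if b \<in> fst p then snd (snd z) else o')" for z :: "'a \<times> 'a \<times> 'a" and p :: "nat set \<times> (nat \<Rightarrow> 'a)"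
  let ?q = "\<lambda>z. e (F (u z))"
  have Fu: "(\<lambda>z. F (u z)) \<in> Pol gens3"
  proof (rule pol_col_subst[OF F(1)])
    fix p :: "nat set \<times> (nat \<Rightarrow> 'a)"
    have "fst \<in> Pol gens3" "(\<lambda>x. fst (snd x)) \<in> Pol gens3" "(\<lambda>x. snd (snd x)) \<in> Pol gens3"
      "(\<lambda>x. o') \<in> Pol gens3"
      by (auto intro: pol.gen pol.const oA)
    then show "(\<lambda>z. u z p) \<in> Pol gens3"
      unfolding u_def by (cases "a \<in> fst p"; cases "b \<in> fst p") simp_all
  qed
  have q: "?q \<in> Pol gens3" by (rule Pol1_subst[OF e Fu])
  have FuA: "F (u (w, x, y)) \<in> A" if "w \<in> A" "x \<in> A" "y \<in> A" for w x y
    by (rule Pol_closed[OF Fu]) (use that in auto)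
  show ?case
  proof (rule maltsev_on_extend[OF q g])
    show "e ` A \<subseteq> A" "o' \<in> A" using eA oA by auto
    show "?q (w, x, y) \<in> e ` A" if "w \<in> A" "x \<in> A" "y \<in> A" for w x y using FuA[OF that] by simp
    show "g x \<in> e ` A" if "x \<in> A" for x using hA[OF that] by (simp add: g_def)
    \<comment> \<open>With \<open>o'\<close> as last argument, exactly the columns containing
      \<open>a\<close> carry \<open>x\<close>, as in row \<open>a\<close>; so the diagonal is a twin
      of \<open>e\<close> applied twice.\<close>
    show "twin (\<lambda>x. ?q (x, x, o')) (\<lambda>x. e (F (row a x)))"
    proof (rule twin_comp[OF ee twin_col_subst[OF F(1)]])
      fix p assume "p \<in> cols A (insert a (insert b I))"
      from twin_const[OF oA pc[OF this, of a]]
      show "twin (\<lambda>x. u (x, x, o') p) (\<lambda>x. row a x p)"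
        using twin_id by (cases "a \<in> fst p"; cases "b \<in> fst p") (simp_all add: u_def row_def case_prod_beta')
    qed
    show "twin (\<lambda>x. ?q (x, o', x)) (\<lambda>x. e (F (row b x)))"
    proof (rule twin_comp[OF ee twin_col_subst[OF F(1)]])
      fix p assume "p \<in> cols A (insert a (insert b I))"
      from twin_const[OF oA pc[OF this, of b]]
      show "twin (\<lambda>x. u (x, o', x) p) (\<lambda>x. row b x p)"
        using twin_id by (cases "a \<in> fst p"; cases "b \<in> fst p") (simp_all add: u_def row_def case_prod_beta')
    qed
    show "e (F (row a x)) = x" "e (F (row b x)) = x" if "x \<in> e ` A" for x
      using that F(2)[of b] F(3) insert.prems(3) eA by auto
    \<comment> \<open>With \<open>x\<close> and \<open>y\<close> as parameters only the columns
      common to both rows vary, as in \<open>h\<close>.\<close>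
    show "twin (\<lambda>w. ?q (w, x, y)) g" if "x \<in> A" "y \<in> A" for x y
      unfolding g_def[abs_def] h_def[abs_def]
    proof (rule twin_comp[OF ee twin_col_subst[OF F(1)]])
      fix p assume "p \<in> cols A (insert a (insert b I))"
      from twin_const[OF _ pc[OF this, of a]]
      show "twin (\<lambda>w. u (w, x, y) p) (\<lambda>x. if a \<in> fst p \<and> b \<in> fst p then x else snd p a)"
        using twin_id that oA by (cases "a \<in> fst p"; cases "b \<in> fst p") (simp_all add: u_def)
    qed
    show "maltsev_on ((g ^^ N) ` A)"
    proof (rule insert.IH[OF ab(2) gN])
      have "g ` A \<subseteq> A" using eA hA by (auto simp: g_def)
      then show "(g ^^ N) ((g ^^ N) x) = (g ^^ N) x" if "x \<in> A" for x
        using funpow_fact_idem[OF fin le_refl _ that] by blast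
    qed
  qed
qed

section \<open>Translation from and to polynomials on lists\<close>

lemma pol_ops_subst:
  assumes "F \<in> pol_ops A ar ops n" "\<And>j. j < n \<Longrightarrow> u j \<in> Pol G"
  shows "(\<lambda>i. F (map (\<lambda>j. u j i) [0..<n])) \<in> Pol G"
  using assms(1)
proof induction
  case (proj i) then show ?case using assms(2) by simp
next
  case (const c) then show ?case by (simp add: pol.const)
next
  case (app gs f)
  have "(\<lambda>i. ops f (map (\<lambda>h. h i) (map (\<lambda>g i. g (map (\<lambda>j. u j i) [0..<n])) gs))) \<in> Pol G"
    by (rule pol.app) (use app in auto)
  then show ?case by (simp add: comp_def)
qed

lemma Pol3_pol_ops:
  assumes "m \<in> Pol gens3"
  shows "\<exists>m' \<in> pol_ops A ar ops 3. \<forall>x y z. m' [x, y, z] = m (x, y, z)"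
  using assms
proof induction
  case (gen g)
  then consider "g = fst" | "g = (\<lambda>x. fst (snd x))" | "g = (\<lambda>x. snd (snd x))" by auto
  then show ?case
  proof cases
    case 1 then show ?thesis by (intro bexI[of _ "\<lambda>xs. xs ! 0"] pol_ops.proj) auto
  next
    case 2 then show ?thesis by (intro bexI[of _ "\<lambda>xs. xs ! 1"] pol_ops.proj) auto
  next
    case 3 then show ?thesis by (intro bexI[of _ "\<lambda>xs. xs ! 2"] pol_ops.proj) auto
  qed
next
  case (const c)
  then show ?case by (intro bexI[of _ "\<lambda>xs. c"] pol_ops.const) auto
next
  case (app gs f)
  then obtain T where T: "\<And>g. g \<in> set gs \<Longrightarrow> T g \<in> pol_ops A ar ops 3 \<and>
    (\<forall>x y z. T g [x, y, z] = g (x, y, z))"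
    by metis
  have "(\<lambda>xs. ops f (map (\<lambda>g. g xs) (map T gs))) \<in> pol_ops A ar ops 3"
    using app(1) T by (intro pol_ops.app) auto
  then show ?case
    by (rule rev_bexI) (use T in \<open>auto intro!: arg_cong[where f = "ops f"]\<close>)
qed

text \<open>Variables other than the distinguished one are specialised to a fixed element. Row
  \<open>0\<close>, which exists because \<open>k \<ge> 1\<close>, is singled out.\<close>

lemma pointed_cube_cube_row:
  assumes "has_pointed_cube_polynomial A ar ops"
  shows "\<exists>I e. finite I \<and> 0 \<notin> I \<and> cube_row 0 I e \<and> (\<forall>x\<in>A. e x = x)"
proof -
  from assms obtain k m F M where k: "k \<ge> (1::nat)" and F: "F \<in> pol_ops A ar ops m"
    and entries: "\<forall>r<k. \<forall>j<m. \<forall>c. M r j = Inr c \<longrightarrow> c \<in> A"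
    and columns: "\<forall>j<m. \<exists>r<k. M r j \<noteq> Inl 0"
    and rows: "\<forall>v. (\<forall>i. v i \<in> A) \<longrightarrow>
      (\<forall>r<k. F (map (\<lambda>j. eval_entry v (M r j)) [0..<m]) = v 0)"
    unfolding has_pointed_cube_polynomial_def by (elim exE conjE)
  obtain d where d: "d \<in> A" using alg unfolding is_algebra_def by auto
  \<comment> \<open>\<open>d\<close> replaces the other variables and also fills the rows from
    \<open>k\<close> on, where entries of \<open>M\<close> need not lie in \<open>A\<close>.\<close>
  define col where "col j = ({r. r < k \<and> M r j = Inl 0},
    \<lambda>r. case M r j of Inl _ \<Rightarrow> d | Inr c \<Rightarrow> if r < k then c else d)" for j
  define G where "G \<alpha> = F (map (\<lambda>j. \<alpha> (col j)) [0..<m])" for \<alpha> :: "nat set \<times> (nat \<Rightarrow> 'a) \<Rightarrow> 'a"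
  have I: "insert 0 {1..<k} = {..<k}" using k by auto
  have "col j \<in> cols A {..<k}" if "j < m" for j
  proof -
    have "{r. r < k \<and> M r j = Inl 0} \<subset> {..<k}" using columns that by auto
    moreover have "(case M r j of Inl _ \<Rightarrow> d | Inr c \<Rightarrow> if r < k then c else d) \<in> A" for r
      using entries that d by (cases "M r j") auto
    ultimately show ?thesis unfolding col_def cols_def by auto
  qed
  then have "G \<in> Pol (col_gens A {..<k})"
    unfolding G_def[abs_def] by (intro pol_ops_subst[OF F] col_in_Pol)
  moreover have row: "G (row r x) = x" if "r < k" "x \<in> A" for r x
  proof -
    define v where "v i = (if i = 0 then x else d)" for i :: nat
    have "row r x (col j) = eval_entry v (M r j)" for j
      using that by (cases "M r j") (auto simp: row_def col_def v_def)
    then have "G (row r x) = v 0"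
      unfolding G_def using rows[rule_format, of v r] that d by (simp add: v_def)
    then show ?thesis by (simp add: v_def)
  qed
  ultimately have "cube_row 0 {1..<k} (\<lambda>x. G (row 0 x))"
    unfolding cube_row_def I by (intro bexI[of _ G]) auto
  moreover have "\<forall>x\<in>A. G (row 0 x) = x" using row k by auto
  ultimately show ?thesis by (intro exI[of _ "{1..<k}"] exI[of _ "\<lambda>x. G (row 0 x)"]) auto
qed

lemma pointed_cube_imp_maltsev:
  assumes "has_pointed_cube_polynomial A ar ops"
  shows "has_maltsev_polynomial A ar ops"
proof -
  obtain I e where I: "finite I" "0 \<notin> I" "cube_row 0 I e" "\<And>x. x \<in> A \<Longrightarrow> e x = x"
    using pointed_cube_cube_row[OF assms] by auto
  then have "maltsev_on (e ` A)" by (intro cube_row_maltsev[OF I(1-3)]) auto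
  moreover have "e ` A = A" using I(4) by simp
  ultimately obtain m where m: "m \<in> Pol gens3"
    "\<forall>x\<in>A. \<forall>y\<in>A. m (x, y, y) = x \<and> m (y, y, x) = x"
    unfolding maltsev_on_def by auto
  obtain m' where "m' \<in> pol_ops A ar ops 3" "\<And>x y z. m' [x, y, z] = m (x, y, z)"
    using Pol3_pol_ops[OF m(1)] by auto
  then show ?thesis unfolding has_maltsev_polynomial_def using m(2) by (intro bexI[of _ m']) auto
qed

end

text \<open>The Maltsev identities are the rows \<open>x, y, y\<close> and \<open>y, y, x\<close> of
  a matrix without constants, each column of which contains \<open>y\<close>.\<close>

lemma maltsev_imp_pointed_cube:
  assumes "has_maltsev_polynomial A ar ops"
  shows "has_pointed_cube_polynomial A ar ops"
proof -
  obtain F where F: "F \<in> pol_ops A ar ops 3" "\<And>x y. x \<in> A \<Longrightarrow> y \<in> A \<Longrightarrow> F [x, y, y] = x \<and> F [y, y, x] = x"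
    using assms unfolding has_maltsev_polynomial_def by blast
  define M :: "nat \<Rightarrow> nat \<Rightarrow> nat + 'a" where
    "M r j = (if r = 0 then [Inl 0, Inl 1, Inl 1] ! j else [Inl 1, Inl 1, Inl 0] ! j)" for r j
  have j3: "j < 3 \<Longrightarrow> j = 0 \<or> j = 1 \<or> j = 2" for j :: nat by auto
  have up: "[0..<3] = [0, 1, 2::nat]" by (simp add: upt_rec)
  show ?thesis
    unfolding has_pointed_cube_polynomial_def
  proof (rule exI[of _ 2], rule exI[of _ 3], rule exI[of _ F], rule exI[of _ M], intro conjI allI impI)
    show "F \<in> pol_ops A ar ops 3" by (rule F(1))
    show "c \<in> A" if "r < 2" "j < 3" "M r j = Inr c" for r j c
      using that j3[of j] by (auto simp: M_def split: if_splits)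
    show "\<exists>r<2. M r j \<noteq> Inl 0" if "j < 3" for j
      using j3[OF that] by (auto simp: M_def intro: exI[of _ 0] exI[of _ 1])
    show "F (map (\<lambda>j. eval_entry v (M r j)) [0..<3]) = v 0" if "\<forall>i. v i \<in> A" "r < 2" for v r
      using F(2)[of "v 0" "v 1"] that by (simp add: M_def up)
  qed simp
qed

theorem theorem6p1:
  fixes A :: "'a set" and ar :: "'f \<Rightarrow> nat" and ops :: "'f \<Rightarrow> 'a list \<Rightarrow> 'a"
  assumes "is_algebra A ar ops" and "finite A" and "left_nilpotent A ar ops"
  shows "has_maltsev_polynomial A ar ops \<longleftrightarrow> has_pointed_cube_polynomial A ar ops"
proof -
  interpret left_nilpotent_algebra A ar ops by unfold_locales (fact assms)+
  show ?thesis using maltsev_imp_pointed_cube pointed_cube_imp_maltsev by blast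
qed

end
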